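(* Consider the CTH-RV car-following system with parameter vector $\theta=(k_1,k_2,\tau)\in\Theta=\{(k_1,k_2,\tau)\in\mathbb{R}^3: k_1\ge 0,\ k_2\ge 0\}$, initial condition $x_0=(s_0,v_0)\in\mathbb{R}^2$ and scalar input $u$: $$\dot s(t)=u(t)-v(t),\qquad \dot v(t)=k_1\bigl(s(t)-\tau v(t)\bigr)+k_2\bigl(u(t)-v(t)\bigr),\qquad s(0)=s_0,\ v(0)=v_0,$$ with output $y(t,\theta,x_0,u)=s(t)$. Under a constant input and the corresponding equilibrium initial condition the system is unidentifiable. That is, for every $u_0\in\mathbb{R}$ and every $\theta=(k_1,k_2,\tau)\in\Theta$, with constant input $u(t)\equiv u_0$ and initial condition $x_0^*=(\tau u_0,\,u_0)$, every neighborhood of $\theta$ in $\Theta$ contains two distinct parameter vectors $\theta_1\neq\theta_2$ with $$y(t,\theta_1,x_0^*,u)=y(t,\theta_2,x_0^*,u)\quad\text{for all } t>0 .$$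
   Context: The CTH-RV (constant-time headway relative-velocity) model describes a vehicle following a leader: $s$ is the space gap, $v$ the follower's velocity, and the input $u$ the leader's velocity. The gains $k_1,k_2$ are non-negative and $\tau$ is the constant time headway; the parameters do not vary in time. Only the space gap is measured. Local identifiability at $\theta$ (for given $x_0$ and $u$) means that some neighborhood $\mathcal N(\theta)$ exists such that for $\theta_1,\theta_2\in\mathcal N(\theta)$, equality of the outputs for all $t>0$ implies $\theta_1=\theta_2$; "unidentifiable" is the negation of this. Neighborhoods are taken in $\Theta$ with the subspace topology. In the claim, the initial condition $x_0^*=(\tau u_0,u_0)$ is computed from the given $\theta$ and is then kept fixed when the parameters are varied to $\theta_1,\theta_2$. *)

theory Defs
  imports "HOL-Analysis.Analysis"
begin

type_synonym param = "real \<times> real \<times> real"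

definition Theta :: "param set" where
  "Theta = {(k1, k2, \<tau>). k1 \<ge> 0 \<and> k2 \<ge> 0}"

text \<open>The system lives on the time axis \<open>t \<ge> 0\<close>; derivatives are taken within
  \<open>{0..}\<close>, hence one-sided at \<open>0\<close>. Values at negative times are irrelevant.\<close>

definition cth_rv_solution ::
    "param \<Rightarrow> real \<times> real \<Rightarrow> (real \<Rightarrow> real) \<Rightarrow> (real \<Rightarrow> real) \<Rightarrow> (real \<Rightarrow> real) \<Rightarrow> bool" where
  "cth_rv_solution \<theta> x0 u s v \<longleftrightarrow>
     (case \<theta> of (k1, k2, \<tau>) \<Rightarrow>
        (s 0, v 0) = x0 \<and>
        (\<forall>t\<ge>0. (s has_real_derivative u t - v t) (at t within {0..})) \<and>
        (\<forall>t\<ge>0. (v has_real_derivative k1 * (s t - \<tau> * v t) + k2 * (u t - v t))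
                  (at t within {0..})))"

text \<open>The description is proper for \<open>t \<ge> 0\<close> and \<open>u\<close> continuous on \<open>{0..}\<close>: see
  \<open>cth_rv_solution_exists\<close> and \<open>cth_rv_output_eq\<close> below.\<close>

definition cth_rv_output :: "real \<Rightarrow> param \<Rightarrow> real \<times> real \<Rightarrow> (real \<Rightarrow> real) \<Rightarrow> real" where
  "cth_rv_output t \<theta> x0 u = (THE y. \<exists>s v. cth_rv_solution \<theta> x0 u s v \<and> y = s t)"

definition nhd_in_Theta :: "param \<Rightarrow> param set \<Rightarrow> bool" where
  "nhd_in_Theta \<theta> N \<longleftrightarrow>
     N \<subseteq> Theta \<and> (\<exists>U. openin (top_of_set Theta) U \<and> \<theta> \<in> U \<and> U \<subseteq> N)"

definition locally_identifiable :: "param \<Rightarrow> real \<times> real \<Rightarrow> (real \<Rightarrow> real) \<Rightarrow> bool" where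
  "locally_identifiable \<theta> x0 u \<longleftrightarrow>
     (\<exists>N. nhd_in_Theta \<theta> N \<and>
        (\<forall>\<theta>1\<in>N. \<forall>\<theta>2\<in>N.
           (\<forall>t>0. cth_rv_output t \<theta>1 x0 u = cth_rv_output t \<theta>2 x0 u) \<longrightarrow> \<theta>1 = \<theta>2))"

subsection \<open>Well-posedness\<close>

lemma cth_rv_solution_unique:
  assumes 1: "cth_rv_solution \<theta> x0 u s v" and 2: "cth_rv_solution \<theta> x0 u s' v'" and t: "t \<ge> 0"
  shows "s t = s' t \<and> v t = v' t"
proof -
  obtain k1 k2 \<tau> where \<theta>: "\<theta> = (k1, k2, \<tau>)" by (cases \<theta>)
  define p where "p r = s r - s' r" for r
  define q where "q r = v r - v' r" for r
  define a where "a = k1 * \<tau> + k2"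
  define C where "C = 1 + \<bar>k1\<bar> + 2 * \<bar>a\<bar>"
  define E where "E r = exp (- C * r) * ((p r)\<^sup>2 + (q r)\<^sup>2)" for r
  have dp: "(p has_real_derivative - q r) (at r within {0..})" if "r \<ge> 0" for r
    using 1 2 that unfolding cth_rv_solution_def \<theta> p_def[abs_def] q_def
    by (auto intro!: derivative_eq_intros)
  have dq: "(q has_real_derivative k1 * p r - a * q r) (at r within {0..})" if "r \<ge> 0" for r
    using 1 2 that unfolding cth_rv_solution_def \<theta> p_def q_def[abs_def] a_def
    by (auto intro!: derivative_eq_intros simp: algebra_simps)
  have dE: "(E has_real_derivative
      exp (- C * r) * (2 * p r * (- q r) + 2 * q r * (k1 * p r - a * q r)
        - C * ((p r)\<^sup>2 + (q r)\<^sup>2))) (at r within {0..})" if "r \<ge> 0" for r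
    unfolding E_def[abs_def]
    by (rule derivative_eq_intros dp dq that refl)+ (simp add: algebra_simps)
  have neg: "exp (- C * r) * (2 * p r * (- q r) + 2 * q r * (k1 * p r - a * q r)
        - C * ((p r)\<^sup>2 + (q r)\<^sup>2)) \<le> 0" for r
  proof -
    have A: "2 * \<bar>p r * q r\<bar> \<le> (p r)\<^sup>2 + (q r)\<^sup>2"
      using sum_squares_bound[of "\<bar>p r\<bar>" "\<bar>q r\<bar>"] by (simp add: abs_mult)
    have B: "2 * p r * (- q r) \<le> (p r)\<^sup>2 + (q r)\<^sup>2"
      using A abs_ge_minus_self[of "p r * q r"] by linarith
    have "2 * (k1 * (p r * q r)) \<le> \<bar>k1\<bar> * (2 * \<bar>p r * q r\<bar>)"
      using abs_ge_self[of "k1 * (p r * q r)"] by (simp add: abs_mult)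
    also have "\<dots> \<le> \<bar>k1\<bar> * ((p r)\<^sup>2 + (q r)\<^sup>2)"
      by (rule mult_left_mono[OF A]) simp
    finally have K: "2 * (k1 * (p r * q r)) \<le> \<bar>k1\<bar> * ((p r)\<^sup>2 + (q r)\<^sup>2)" .
    have "- (2 * (a * (q r)\<^sup>2)) \<le> 2 * (\<bar>a\<bar> * (q r)\<^sup>2)"
      using abs_ge_minus_self[of "a * (q r)\<^sup>2"] by (simp add: abs_mult)
    also have "\<dots> \<le> 2 * (\<bar>a\<bar> * ((p r)\<^sup>2 + (q r)\<^sup>2))"
      by (intro mult_left_mono) auto
    finally have D: "- (2 * (a * (q r)\<^sup>2)) \<le> 2 * (\<bar>a\<bar> * ((p r)\<^sup>2 + (q r)\<^sup>2))" .
    have "2 * p r * (- q r) + 2 * q r * (k1 * p r - a * q r) - C * ((p r)\<^sup>2 + (q r)\<^sup>2)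
        = (2 * p r * (- q r) - ((p r)\<^sup>2 + (q r)\<^sup>2))
          + (2 * (k1 * (p r * q r)) - \<bar>k1\<bar> * ((p r)\<^sup>2 + (q r)\<^sup>2))
          + (- (2 * (a * (q r)\<^sup>2)) - 2 * (\<bar>a\<bar> * ((p r)\<^sup>2 + (q r)\<^sup>2)))"
      unfolding C_def by (simp add: algebra_simps power2_eq_square)
    also have "\<dots> \<le> 0" using B K D by linarith
    finally show ?thesis by (simp add: mult_le_0_iff)
  qed
  have "E t \<le> E 0"
  proof (cases "t = 0")
    case False
    with t have t0: "0 < t" by simp
    have dE': "\<exists>y\<le>0. (E has_real_derivative y) (at r)" if r: "0 < r" for r
    proof -
      have "at r within {0..} = at r"
        using r by (intro at_within_interior) auto
      then show ?thesis
        using dE[of r] neg[of r] r by auto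
    qed
    have "continuous_on {0..} E"
      by (rule DERIV_continuous_on) (rule dE, simp)
    then have "continuous_on {0..t} E"
      by (rule continuous_on_subset) auto
    then obtain l r where r: "0 < r" "(E has_real_derivative l) (at r)" "E t - E 0 = (t - 0) * l"
      using MVT[OF t0, of E] dE' real_differentiable_def by blast
    then have "l \<le> 0" using dE'[of r] DERIV_unique by blast
    then have "(t - 0) * l \<le> 0" using t by (intro mult_nonneg_nonpos) auto
    with r(3) show ?thesis by linarith
  qed simp
  moreover have "E 0 = 0"
    using 1 2 unfolding cth_rv_solution_def \<theta> E_def p_def q_def by auto
  ultimately have "(p t)\<^sup>2 + (q t)\<^sup>2 \<le> 0"
    unfolding E_def by (simp add: mult_le_0_iff)
  then have "p t = 0 \<and> q t = 0"
    by (simp add: sum_power2_le_zero_iff)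
  then show ?thesis by (simp add: p_def q_def)
qed

lemma cth_rv_output_eq:
  assumes "cth_rv_solution \<theta> x0 u s v" "t \<ge> 0"
  shows "cth_rv_output t \<theta> x0 u = s t"
  unfolding cth_rv_output_def
  by (rule the_equality) (use assms cth_rv_solution_unique in blast)+

lemma scalar_linear_ode_exists:
  fixes \<mu> w0 :: complex and g :: "real \<Rightarrow> complex"
  assumes g: "continuous_on {0..} g"
  obtains w where "w 0 = w0"
    "\<And>t. t \<ge> 0 \<Longrightarrow> (w has_vector_derivative \<mu> * w t + g t) (at t within {0..})"
proof -
  define h where "h r = exp (- \<mu> * of_real r) * g r" for r :: real
  define I where "I t = integral {0..t} h" for t
  define w where "w t = exp (\<mu> * of_real t) * (w0 + I t)" for t :: real
  have h: "continuous_on {0..} h"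
    unfolding h_def[abs_def] by (intro continuous_intros g)
  have dI: "(I has_vector_derivative h t) (at t within {0..})" if t: "t \<ge> 0" for t
  proof -
    have "(I has_vector_derivative h t) (at t within {0..t+1})"
      unfolding I_def[abs_def] using t
      by (intro integral_has_vector_derivative continuous_on_subset[OF h]) auto
    moreover have "at t within {0..t+1} = at t within {0..}"
      by (rule at_within_nhd[of t "{..<t+1}"]) auto
    ultimately show ?thesis by simp
  qed
  have dexp: "((\<lambda>t. exp (\<mu> * of_real t)) has_vector_derivative exp (\<mu> * of_real t) * \<mu>)
      (at t within {0..})" for t :: real
  proof -
    have "((\<lambda>t. exp (t *\<^sub>R \<mu>)) has_vector_derivative exp (t *\<^sub>R \<mu>) * \<mu>) (at t within {0..})"
      by (rule exp_scaleR_has_vector_derivative_right)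
    then show ?thesis by (simp add: scaleR_conv_of_real mult.commute)
  qed
  have "(w has_vector_derivative \<mu> * w t + g t) (at t within {0..})" if t: "t \<ge> 0" for t
  proof -
    have "((\<lambda>t. w0 + I t) has_vector_derivative h t) (at t within {0..})"
      using has_vector_derivative_add[OF has_vector_derivative_const dI[OF t]] by simp
    from has_vector_derivative_mult[OF dexp this]
    show ?thesis
      unfolding w_def[abs_def] h_def
      by (simp add: algebra_simps exp_minus_inverse flip: mult.assoc exp_add)
  qed
  moreover have "w 0 = w0" by (simp add: w_def I_def)
  ultimately show ?thesis using that by blast
qed

lemma cth_rv_solution_exists:
  assumes u: "continuous_on {0..} u"
  shows "\<exists>s v. cth_rv_solution \<theta> x0 u s v"
proof -
  obtain k1 k2 \<tau> where \<theta>: "\<theta> = (k1, k2, \<tau>)" by (cases \<theta>)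
  obtain s0 v0 where x0: "x0 = (s0, v0)" by (cases x0)
  define a where "a = complex_of_real (k1 * \<tau> + k2)"
  define c where "c = (- a + csqrt (a\<^sup>2 - 4 * of_real k1)) / 2"
  have c: "of_real k1 = - (a + c) * c"
  proof -
    have "(2 * c + a)\<^sup>2 = a\<^sup>2 - 4 * of_real k1"
    proof -
      have "2 * c + a = csqrt (a\<^sup>2 - 4 * of_real k1)"
        unfolding c_def by (simp add: field_simps)
      then show ?thesis by simp
    qed
    then have "4 * of_real k1 = 4 * (- (a + c) * c)"
      by (simp add: power2_eq_square algebra_simps eq_neg_iff_add_eq_0)
    then show ?thesis by (simp only: mult_left_cancel zero_neq_numeral[symmetric] simp_thms)
  qed
  have cu: "continuous_on {0..} (\<lambda>t. complex_of_real (u t))"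
    by (intro continuous_intros u)
  obtain z where z: "z 0 = of_real v0 + c * of_real s0"
    "\<And>t. t \<ge> 0 \<Longrightarrow> (z has_vector_derivative - (a + c) * z t + (of_real k2 + c) * of_real (u t))
       (at t within {0..})"
    by (rule scalar_linear_ode_exists[OF continuous_on_mult_left[OF cu],
          of "of_real v0 + c * of_real s0" "- (a + c)" "of_real k2 + c"]) blast
  have cz: "continuous_on {0..} z"
    by (rule continuous_on_vector_derivative) (rule z(2), simp)
  have "continuous_on {0..} (\<lambda>t. of_real (u t) - z t)"
    by (intro continuous_intros cu cz)
  then obtain S where S: "S 0 = of_real s0"
    "\<And>t. t \<ge> 0 \<Longrightarrow> (S has_vector_derivative c * S t + (of_real (u t) - z t)) (at t within {0..})"
    by (rule scalar_linear_ode_exists[of _ "of_real s0" c]) blast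
  define V where "V t = z t - c * S t" for t
  have dS: "(S has_vector_derivative of_real (u t) - V t) (at t within {0..})" if "t \<ge> 0" for t
    using S(2)[OF that] by (simp add: V_def algebra_simps)
  have dV: "(V has_vector_derivative of_real k1 * S t - a * V t + of_real k2 * of_real (u t))
      (at t within {0..})" if "t \<ge> 0" for t
  proof -
    have "(V has_vector_derivative (- (a + c) * z t + (of_real k2 + c) * of_real (u t))
        - c * (of_real (u t) - V t)) (at t within {0..})"
      unfolding V_def[abs_def]
      by (intro has_vector_derivative_diff z(2) that has_vector_derivative_mult_right
          dS[unfolded V_def])
    also have "(- (a + c) * z t + (of_real k2 + c) * of_real (u t)) - c * (of_real (u t) - V t)
        = of_real k1 * S t - a * V t + of_real k2 * of_real (u t)"
      unfolding c V_def by (simp add: algebra_simps)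
    finally show ?thesis .
  qed
  have re: "((\<lambda>t. Re (f t)) has_real_derivative Re f') (at t within {0..})"
    if "(f has_vector_derivative f') (at t within {0..})" for f f' and t :: real
    using bounded_linear.has_vector_derivative[OF bounded_linear_Re that]
    by (simp add: has_real_derivative_iff_has_vector_derivative)
  have "cth_rv_solution \<theta> x0 u (\<lambda>t. Re (S t)) (\<lambda>t. Re (V t))"
    unfolding cth_rv_solution_def \<theta> x0 prod.case
  proof (intro conjI allI impI)
    show "(Re (S 0), Re (V 0)) = (s0, v0)"
      by (simp add: V_def z(1) S(1))
  next
    fix t :: real assume t: "t \<ge> 0"
    show "((\<lambda>t. Re (S t)) has_real_derivative u t - Re (V t)) (at t within {0..})"
      using re[OF dS[OF t]] by simp
    show "((\<lambda>t. Re (V t)) has_real_derivative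
        k1 * (Re (S t) - \<tau> * Re (V t)) + k2 * (u t - Re (V t))) (at t within {0..})"
      using re[OF dV[OF t]] by (simp add: a_def algebra_simps)
  qed
  then show ?thesis by blast
qed

end

theory Submission
  imports Defs
begin

text \<open>The equilibrium gap \<open>\<tau> * u0\<close> does not depend on the gains, so the output is the same
  constant for all \<open>k1\<close> and \<open>k2\<close>; increasing \<open>k2\<close> slightly stays inside \<open>Theta\<close>.\<close>

text \<open>Along these constants both \<open>s t - \<tau> * v t\<close> and
  \<open>u t - v t\<close> are zero, so each gain multiplies zero and both derivatives
  vanish.\<close>

lemma cth_rv_solution_equilibrium:
  "cth_rv_solution (k1, k2, \<tau>) (\<tau> * u0, u0) (\<lambda>t. u0) (\<lambda>t. \<tau> * u0) (\<lambda>t. u0)"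
  by (simp add: cth_rv_solution_def)

text \<open>By uniqueness of solutions, the definite description in the output selects the
  equilibrium.\<close>

lemma cth_rv_output_equilibrium:
  assumes "t \<ge> 0"
  shows "cth_rv_output t (k1, k2, \<tau>) (\<tau> * u0, u0) (\<lambda>t. u0) = \<tau> * u0"
  by (rule cth_rv_output_eq[OF cth_rv_solution_equilibrium assms])

text \<open>Moving upwards in \<open>k2\<close> also works on the boundary \<open>k2 = 0\<close>,
  where a decrease would leave \<open>Theta\<close>.\<close>

lemma nhd_in_Theta_increase_k2:
  assumes N: "nhd_in_Theta (k1, k2, \<tau>) N"
  obtains d where "d > 0" "(k1, k2, \<tau>) \<in> N" "(k1, k2 + d, \<tau>) \<in> N"
proof -
  obtain U where U: "openin (top_of_set Theta) U" "(k1, k2, \<tau>) \<in> U" "U \<subseteq> N"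
    using N unfolding nhd_in_Theta_def by blast
  then obtain e where e: "e > 0" "ball (k1, k2, \<tau>) e \<inter> Theta \<subseteq> U"
    unfolding openin_contains_ball by blast
  have "(k1, k2, \<tau>) \<in> Theta"
    using N U unfolding nhd_in_Theta_def by blast
  \<comment> \<open>Only one coordinate changes, so the distance is exactly
    \<open>e / 2\<close>.\<close>
  then have "(k1, k2 + e / 2, \<tau>) \<in> ball (k1, k2, \<tau>) e \<inter> Theta"
    using e(1) by (simp add: Theta_def dist_Pair_Pair dist_real_def)
  then have "(k1, k2 + e / 2, \<tau>) \<in> N"
    using e(2) U(3) by blast
  then show ?thesis
    by (intro that[of "e / 2"]) (use e(1) U in auto)
qed

theorem proposition2:
  fixes u0 k1 k2 \<tau> :: real
  assumes "(k1, k2, \<tau>) \<in> Theta"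
  shows "\<not> locally_identifiable (k1, k2, \<tau>) (\<tau> * u0, u0) (\<lambda>t. u0) \<and>
    (\<forall>N. nhd_in_Theta (k1, k2, \<tau>) N \<longrightarrow>
      (\<exists>\<theta>1\<in>N. \<exists>\<theta>2\<in>N. \<theta>1 \<noteq> \<theta>2 \<and>
        (\<forall>t>0. cth_rv_output t \<theta>1 (\<tau> * u0, u0) (\<lambda>t. u0)
             = cth_rv_output t \<theta>2 (\<tau> * u0, u0) (\<lambda>t. u0))))"
proof -
  have "\<exists>\<theta>1\<in>N. \<exists>\<theta>2\<in>N. \<theta>1 \<noteq> \<theta>2 \<and>
        (\<forall>t>0. cth_rv_output t \<theta>1 (\<tau> * u0, u0) (\<lambda>t. u0)
             = cth_rv_output t \<theta>2 (\<tau> * u0, u0) (\<lambda>t. u0))"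
    if N: "nhd_in_Theta (k1, k2, \<tau>) N" for N
  proof -
    obtain d where d: "d > 0" "(k1, k2, \<tau>) \<in> N" "(k1, k2 + d, \<tau>) \<in> N"
      by (rule nhd_in_Theta_increase_k2[OF N])
    have "(k1, k2, \<tau>) \<noteq> (k1, k2 + d, \<tau>)"
      using d(1) by simp
    \<comment> \<open>Both parameters share the \<open>\<tau>\<close> that fixes the initial gap, so
      this gap is an equilibrium for both.\<close>
    moreover have "\<forall>t>0. cth_rv_output t (k1, k2, \<tau>) (\<tau> * u0, u0) (\<lambda>t. u0)
        = cth_rv_output t (k1, k2 + d, \<tau>) (\<tau> * u0, u0) (\<lambda>t. u0)"
      by (simp add: cth_rv_output_equilibrium)
    ultimately show ?thesis
      by (rule bexI[OF bexI[OF conjI d(3)] d(2)])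
  qed
  \<comment> \<open>Each neighborhood now holds a pair refuting injectivity, which gives both
    conjuncts.\<close>
  then show ?thesis
    unfolding locally_identifiable_def by meson
qed

end
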